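(* Let $G$ and $H$ be connected graphs with roots $R_G\subseteq G$ and $R_H\subseteq H$. Then \[Res(G\,\square\,H,\;R_G\,\square\,R_H)\cong Res(G,R_G)\,\square\,Res(H,R_H).\]
   Context: A root of a connected finite graph $G$ is an induced subgraph $R_G=\langle V_0\rangle$ on a nonempty vertex set $V_0$; with $V_i$ the set of vertices at distance exactly $i$ from $V_0$ and $r$ the largest $i$ with $V_i\ne\emptyset$, the distance-residual graph is $Res(G,R_G)=\langle V_r\rangle$. $G\,\square\,H$ denotes the Cartesian product: vertex set $V(G)\times V(H)$, with $(u,x)\sim(v,y)$ iff ($u=v$ and $xy\in E(H)$) or ($x=y$ and $uv\in E(G)$). $R_G\,\square\,R_H$ is the corresponding subgraph of $G\,\square\,H$ (induced on $V(R_G)\times V(R_H)$). *)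

theory Defs
  imports "Graph_Theory.Graph_Theory"
begin

text \<open>
  A finite simple undirected graph is a structure satisfying the locale \<^locale>\<open>graph\<close>: a finite,
  loop-free, symmetric digraph without parallel arcs, each edge being a pair of opposite arcs.
\<close>

definition is_root :: "('a,'b) pre_digraph \<Rightarrow> ('a,'b) pre_digraph \<Rightarrow> bool" where
  "is_root G R \<longleftrightarrow> induced_subgraph R G \<and> verts R \<noteq> {}"

text \<open>
  With unit arc weights, the library's shortest-path cost between two vertices is the usual graph
  distance, i.e. the least length of a walk (infinite if there is none).
\<close>

definition set_dist :: "('a,'b) pre_digraph \<Rightarrow> 'a set \<Rightarrow> 'a \<Rightarrow> ereal" where
  "set_dist G S v = (INF u\<in>S. wf_digraph.\<mu> G (\<lambda>_. 1) u v)"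

definition dist_level :: "('a,'b) pre_digraph \<Rightarrow> 'a set \<Rightarrow> nat \<Rightarrow> 'a set" where
  "dist_level G S i = {v \<in> verts G. set_dist G S v = ereal (real i)}"

definition max_level :: "('a,'b) pre_digraph \<Rightarrow> 'a set \<Rightarrow> nat" where
  "max_level G S = Max {i. dist_level G S i \<noteq> {}}"

definition Res :: "('a,'b) pre_digraph \<Rightarrow> ('a,'b) pre_digraph \<Rightarrow> ('a,'b) pre_digraph" where
  "Res G R = G \<restriction> dist_level G (verts R) (max_level G (verts R))"

definition cart_prod ::
  "('a,'b) pre_digraph \<Rightarrow> ('c,'d) pre_digraph \<Rightarrow> ('a \<times> 'c, ('a \<times> 'c) \<times> ('a \<times> 'c)) pre_digraph"
  (infixl \<open>\<box>\<close> 70) where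
  "G \<box> H = with_proj
    \<lparr> pverts = verts G \<times> verts H,
      parcs = {((u, x), (v, y)) | u x v y.
        (u \<in> verts G \<and> u = v \<and> x \<rightarrow>\<^bsub>H\<^esub> y) \<or> (x \<in> verts H \<and> x = y \<and> u \<rightarrow>\<^bsub>G\<^esub> v)} \<rparr>"

lemma cart_prod_simps [simp]:
  "verts (G \<box> H) = verts G \<times> verts H"
  "tail (G \<box> H) = fst"
  "head (G \<box> H) = snd"
  "((u, x), (v, y)) \<in> arcs (G \<box> H) \<longleftrightarrow>
    (u \<in> verts G \<and> u = v \<and> x \<rightarrow>\<^bsub>H\<^esub> y) \<or> (x \<in> verts H \<and> x = y \<and> u \<rightarrow>\<^bsub>G\<^esub> v)"
  by (auto simp: cart_prod_def)

lemma wf_digraph_cart_prod: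
  assumes "wf_digraph G" "wf_digraph H"
  shows "wf_digraph (G \<box> H)"
proof -
  interpret G: wf_digraph G by fact
  interpret H: wf_digraph H by fact
  show ?thesis
    by unfold_locales (auto simp: cart_prod_def dest: G.adj_in_verts H.adj_in_verts)
qed

lemma graph_cart_prod:
  assumes "graph G" "graph H"
  shows "graph (G \<box> H)"
proof -
  interpret G: graph G by fact
  interpret H: graph H by fact
  interpret P: wf_digraph "G \<box> H"
    by (intro wf_digraph_cart_prod G.wf_digraph H.wf_digraph)
  have nG: "u \<noteq> v" if "u \<rightarrow>\<^bsub>G\<^esub> v" for u v using that G.adj_not_same by blast
  have nH: "u \<noteq> v" if "u \<rightarrow>\<^bsub>H\<^esub> v" for u v using that H.adj_not_same by blast
  have "arcs (G \<box> H) \<subseteq> (verts G \<times> verts H) \<times> (verts G \<times> verts H)"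
    using P.tail_in_verts P.head_in_verts by (auto simp del: cart_prod_simps(4) simp: mem_Times_iff)
  then have fin: "finite (arcs (G \<box> H))"
    by (rule finite_subset) auto
  have sym: "symmetric (G \<box> H)"
    by (auto simp: symmetric_def sym_def cart_prod_def dest: G.graph_symmetric H.graph_symmetric)
  show ?thesis
    using fin sym by unfold_locales (auto simp: arc_to_ends_def cart_prod_def dest: nG nH)
qed

lemma is_root_cart_prod:
  assumes "wf_digraph G" "wf_digraph H" "is_root G R" "is_root H S"
  shows "is_root (G \<box> H) (R \<box> S)"
    and "R \<box> S = (G \<box> H) \<restriction> (verts R \<times> verts S)"
proof -
  interpret G: wf_digraph G by fact
  interpret H: wf_digraph H by fact
  have R: "induced_subgraph R G" "verts R \<noteq> {}" and S: "induced_subgraph S H" "verts S \<noteq> {}"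
    using assms by (auto simp: is_root_def)
  have RG: "verts R \<subseteq> verts G" "wf_digraph R" and SH: "verts S \<subseteq> verts H" "wf_digraph S"
    using R S by (auto simp: induced_subgraph_def subgraph_def)
  have "tail R = tail G" "head R = head G" "tail S = tail H" "head S = head H"
    using R S by (auto simp: induced_subgraph_def subgraph_def compatible_def)
  moreover have "arcs R = {e \<in> arcs G. tail G e \<in> verts R \<and> head G e \<in> verts R}"
    "arcs S = {e \<in> arcs H. tail H e \<in> verts S \<and> head H e \<in> verts S}"
    using R S by (auto simp: induced_subgraph_def)
  ultimately have adj: "u \<rightarrow>\<^bsub>R\<^esub> v \<longleftrightarrow> u \<rightarrow>\<^bsub>G\<^esub> v \<and> u \<in> verts R \<and> v \<in> verts R"
    "x \<rightarrow>\<^bsub>S\<^esub> y \<longleftrightarrow> x \<rightarrow>\<^bsub>H\<^esub> y \<and> x \<in> verts S \<and> y \<in> verts S" for u v x y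
    by (auto simp: arcs_ends_conv)
  show eq: "R \<box> S = (G \<box> H) \<restriction> (verts R \<times> verts S)"
    using RG(1) SH(1)
    by (intro pre_digraph.equality) (auto simp: induce_subgraph_def adj)
  have "induced_subgraph ((G \<box> H) \<restriction> (verts R \<times> verts S)) (G \<box> H)"
    using RG(1) SH(1) assms
    by (intro wf_digraph.induced_induce wf_digraph_cart_prod) auto
  then show "is_root (G \<box> H) (R \<box> S)"
    using R S by (auto simp: is_root_def eq[symmetric])
qed

end

theory Submission
  imports Defs
begin

text \<open>
  A walk in \<open>G \<box> H\<close> is an interleaving of a walk in \<open>G\<close> with a walk in \<open>H\<close>, so distances from
  \<open>R \<box> S\<close> are sums of the distances from \<open>R\<close> and from \<open>S\<close>. Such a sum is maximal exactly when both
  summands are, hence the last level of the product is the product of the last levels. The two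
  graphs are therefore not just isomorphic but equal.
\<close>

text \<open>Distance as a natural number rather than an \<open>ereal\<close>, so that sums cancel
  and maxima over finite sets exist. Walks are powers of the adjacency relation, which split along
  the two factors without lists of arcs. If no vertex of \<open>S\<close> reaches \<open>v\<close>,
  the value is an unspecified \<open>LEAST\<close>.\<close>

definition hop_dist :: "('a,'b) pre_digraph \<Rightarrow> 'a set \<Rightarrow> 'a \<Rightarrow> nat" where
  "hop_dist G S v = (LEAST n. \<exists>u\<in>S. (u, v) \<in> arcs_ends G ^^ n)"

lemma hop_dist_le: "u \<in> S \<Longrightarrow> (u, v) \<in> arcs_ends G ^^ n \<Longrightarrow> hop_dist G S v \<le> n"
  unfolding hop_dist_def by (rule Least_le) blast

text \<open>Links the arc lists behind \<open>\<mu>\<close> to relational powers. The conjunct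
  \<open>u \<in> verts G\<close> matters at \<open>n = 0\<close>, where the power is the identity on
  the whole type; for positive \<open>n\<close> the first arc already forces it.\<close>

lemma (in wf_digraph) ex_awalk_length_iff_relpow:
  "(\<exists>p. awalk u p v \<and> length p = n) \<longleftrightarrow> u \<in> verts G \<and> (u, v) \<in> arcs_ends G ^^ n"
proof (induction n arbitrary: u)
  case 0
  show ?case by (auto simp: awalk_Nil_iff)
next
  case (Suc n)
  have "(\<exists>p. awalk u p v \<and> length p = Suc n) \<longleftrightarrow>
      (\<exists>e p. awalk u (e # p) v \<and> length p = n)"
    by (metis length_Cons length_Suc_conv)
  also have "\<dots> \<longleftrightarrow> (\<exists>e \<in> arcs G. u = tail G e \<and> (\<exists>p. awalk (head G e) p v \<and> length p = n))"
    unfolding awalk_Cons_iff by blast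
  also have "\<dots> \<longleftrightarrow> (\<exists>w. u \<rightarrow> w \<and> (w, v) \<in> arcs_ends G ^^ n)"
    unfolding Suc.IH by (auto simp: arcs_ends_conv)
  also have "\<dots> \<longleftrightarrow> u \<in> verts G \<and> (u, v) \<in> arcs_ends G ^^ Suc n"
    by (metis relpow_Suc_I2 relpow_Suc_D2 adj_in_verts(1))
  finally show ?case .
qed

lemma (in wf_digraph) awalk_cost_one: "awalk_cost (\<lambda>_. 1) p = real (length p)"
  by (induction p) auto

context wf_digraph
begin

text \<open>Strong connectivity gives some walk from \<open>S\<close> to \<open>v\<close>, so the
  \<open>LEAST\<close> ranges over a nonempty set of lengths and is one of them.\<close>

lemma hop_dist_attained:
  assumes "strongly_connected G" "S \<subseteq> verts G" "S \<noteq> {}" "v \<in> verts G"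
  obtains u where "u \<in> S" "(u, v) \<in> arcs_ends G ^^ hop_dist G S v"
proof -
  obtain s where s: "s \<in> S" using assms by blast
  then have "s \<rightarrow>\<^sup>* v" using assms by blast
  then obtain n where "(s, v) \<in> arcs_ends G ^^ n"
    by (meson reachable_rtranclI rtrancl_imp_relpow)
  with s have "\<exists>u\<in>S. (u, v) \<in> arcs_ends G ^^ hop_dist G S v"
    unfolding hop_dist_def by (intro LeastI[of "\<lambda>n. \<exists>u\<in>S. (u, v) \<in> arcs_ends G ^^ n"]) blast
  then show thesis using that by blast
qed

text \<open>With unit weights the cost of a walk is its length. A walk of minimal length bounds the
  infimum from above, and every walk from \<open>S\<close> to \<open>v\<close> bounds
  \<open>hop_dist\<close> from above.\<close>

lemma set_dist_eq_hop_dist: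
  assumes "strongly_connected G" "S \<subseteq> verts G" "S \<noteq> {}" "v \<in> verts G"
  shows "set_dist G S v = ereal (real (hop_dist G S v))"
proof (rule antisym)
  obtain u where u: "u \<in> S" "(u, v) \<in> arcs_ends G ^^ hop_dist G S v"
    using hop_dist_attained[OF assms] by blast
  then obtain p where p: "awalk u p v" "length p = hop_dist G S v"
    using assms(2) ex_awalk_length_iff_relpow by blast
  have "set_dist G S v \<le> \<mu> (\<lambda>_. 1) u v"
    unfolding set_dist_def using u(1) by (rule INF_lower)
  also have "\<dots> \<le> ereal (awalk_cost (\<lambda>_. 1) p)"
    using p(1) by (rule min_cost_le_walk_cost)
  finally show "set_dist G S v \<le> ereal (real (hop_dist G S v))"
    by (simp add: awalk_cost_one p(2))
next
  have "hop_dist G S v \<le> length p" if "u \<in> S" "awalk u p v" for u p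
    using that ex_awalk_length_iff_relpow hop_dist_le by metis
  then show "ereal (real (hop_dist G S v)) \<le> set_dist G S v"
    by (auto simp: set_dist_def \<mu>_def awalk_cost_one intro!: INF_greatest)
qed

end

text \<open>The levels are the fibres of \<open>hop_dist\<close>, so the indices of nonempty levels
  form the image of \<open>verts G\<close>. This image is finite and nonempty, and its
  \<open>Max\<close> is the value at the farthest vertices. No level index appears on the right,
  which makes it easy to compare with the product.\<close>

lemma (in fin_digraph) last_level_eq:
  assumes "strongly_connected G" "S \<subseteq> verts G" "S \<noteq> {}"
  shows "dist_level G S (max_level G S) =
    {v \<in> verts G. \<forall>w \<in> verts G. hop_dist G S w \<le> hop_dist G S v}"
proof -
  have level: "dist_level G S i = {v \<in> verts G. hop_dist G S v = i}" for i
    by (auto simp: dist_level_def set_dist_eq_hop_dist[OF assms])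
  have "{i. dist_level G S i \<noteq> {}} = hop_dist G S ` verts G"
    by (auto simp: level)
  moreover have "verts G \<noteq> {}" using assms by blast
  ultimately show ?thesis
    unfolding level max_level_def by (auto intro!: Max_eqI[symmetric])
qed

lemma adj_cart_prod_iff:
  "(u, x) \<rightarrow>\<^bsub>G \<box> H\<^esub> (v, y) \<longleftrightarrow>
    (u \<in> verts G \<and> u = v \<and> x \<rightarrow>\<^bsub>H\<^esub> y) \<or> (x \<in> verts H \<and> x = y \<and> u \<rightarrow>\<^bsub>G\<^esub> v)"
  by (auto simp: cart_prod_def)

text \<open>Every step in the product moves exactly one coordinate, so counting the steps of each
  kind gives \<open>i\<close> and \<open>j\<close>. Conversely, all \<open>G\<close> steps can be
  made first and the \<open>H\<close> steps afterwards.\<close>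

lemma relpow_cart_prod_iff:
  assumes "wf_digraph G" "u \<in> verts G" "x \<in> verts H"
  shows "((u, x), (v, y)) \<in> arcs_ends (G \<box> H) ^^ n \<longleftrightarrow>
    (\<exists>i j. n = i + j \<and> (u, v) \<in> arcs_ends G ^^ i \<and> (x, y) \<in> arcs_ends H ^^ j)"
proof
  show "\<exists>i j. n = i + j \<and> (u, v) \<in> arcs_ends G ^^ i \<and> (x, y) \<in> arcs_ends H ^^ j"
    if "((u, x), (v, y)) \<in> arcs_ends (G \<box> H) ^^ n"
    using that
  proof (induction n arbitrary: v y)
    case (Suc n)
    then obtain v' y' where "((u, x), (v', y')) \<in> arcs_ends (G \<box> H) ^^ n"
      and step: "(v', y') \<rightarrow>\<^bsub>G \<box> H\<^esub> (v, y)"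
      by auto
    from Suc.IH[OF this(1)] obtain i j where ij: "n = i + j"
      "(u, v') \<in> arcs_ends G ^^ i" "(x, y') \<in> arcs_ends H ^^ j"
      by blast
    from step consider "v' = v" "y' \<rightarrow>\<^bsub>H\<^esub> y" | "y' = y" "v' \<rightarrow>\<^bsub>G\<^esub> v"
      by (auto simp: adj_cart_prod_iff)
    then show ?case
    proof cases
      case 1
      then show ?thesis using ij
        by (intro exI[of _ i] exI[of _ "Suc j"]) auto
    next
      case 2
      then show ?thesis using ij
        by (intro exI[of _ "Suc i"] exI[of _ j]) auto
    qed
  qed auto
next
  interpret G: wf_digraph G by fact
  assume "\<exists>i j. n = i + j \<and> (u, v) \<in> arcs_ends G ^^ i \<and> (x, y) \<in> arcs_ends H ^^ j"
  then obtain i j where n: "n = i + j"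
    and i: "(u, v) \<in> arcs_ends G ^^ i" and j: "(x, y) \<in> arcs_ends H ^^ j"
    by blast
  \<comment> \<open>An \<open>H\<close> step of the product requires its fixed first coordinate to
    be a vertex of \<open>G\<close>; during the second leg that coordinate is
    \<open>v\<close>.\<close>
  have v: "v \<in> verts G"
    using i assms(2) G.adj_in_verts by (cases i) auto
  have "((u, x), (v, x)) \<in> arcs_ends (G \<box> H) ^^ i"
    using i
  proof (induction i arbitrary: v)
    case (Suc i)
    then obtain w where "(u, w) \<in> arcs_ends G ^^ i" "w \<rightarrow>\<^bsub>G\<^esub> v" by auto
    with Suc.IH[of w] assms(3) show ?case
      by (auto simp: adj_cart_prod_iff)
  qed auto
  moreover have "((v, x), (v, y)) \<in> arcs_ends (G \<box> H) ^^ j"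
    using j
  proof (induction j arbitrary: y)
    case (Suc j)
    then obtain z where "(x, z) \<in> arcs_ends H ^^ j" "z \<rightarrow>\<^bsub>H\<^esub> y" by auto
    with Suc.IH[of z] v show ?case
      by (auto simp: adj_cart_prod_iff)
  qed auto
  ultimately show "((u, x), (v, y)) \<in> arcs_ends (G \<box> H) ^^ n"
    unfolding n relpow_add by blast
qed

text \<open>Walks in the two factors combine into one in the product. This lets
  \<open>hop_dist_attained\<close> and \<open>last_level_eq\<close> be applied to the product
  itself.\<close>

lemma strongly_connected_cart_prod:
  assumes "wf_digraph G" "wf_digraph H" "strongly_connected G" "strongly_connected H"
  shows "strongly_connected (G \<box> H)"
proof (rule strongly_connectedI)
  interpret P: wf_digraph "G \<box> H" using assms by (intro wf_digraph_cart_prod)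
  show "verts (G \<box> H) \<noteq> {}"
    using assms by (simp add: strongly_connected_def)
  fix a b assume ab: "a \<in> verts (G \<box> H)" "b \<in> verts (G \<box> H)"
  obtain u x v y where eq: "a = (u, x)" "b = (v, y)" by fastforce
  obtain i j where "(u, v) \<in> arcs_ends G ^^ i" "(x, y) \<in> arcs_ends H ^^ j"
    using ab eq assms(3,4) unfolding strongly_connected_def
    by (metis SigmaD1 SigmaD2 cart_prod_simps(1) reachable_rtranclI rtrancl_imp_relpow)
  then have "(a, b) \<in> arcs_ends (G \<box> H) ^^ (i + j)"
    using ab eq assms by (auto simp: relpow_cart_prod_iff)
  then show "a \<rightarrow>\<^sup>*\<^bsub>G \<box> H\<^esub> b"
    using ab(1) P.ex_awalk_length_iff_relpow P.reachable_awalk by blast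
qed

text \<open>For the upper bound, shortest walks from \<open>S\<close> and from \<open>T\<close> are
  combined. For the lower bound, a shortest walk from \<open>S \<times> T\<close> is split into
  walks from \<open>S\<close> and from \<open>T\<close>, neither shorter than the corresponding
  distance.\<close>

lemma hop_dist_cart_prod:
  assumes "wf_digraph G" "wf_digraph H" "strongly_connected G" "strongly_connected H"
    and "S \<subseteq> verts G" "S \<noteq> {}" "T \<subseteq> verts H" "T \<noteq> {}"
    and "v \<in> verts G" "y \<in> verts H"
  shows "hop_dist (G \<box> H) (S \<times> T) (v, y) = hop_dist G S v + hop_dist H T y"
proof (rule antisym)
  interpret G: wf_digraph G by fact
  interpret H: wf_digraph H by fact
  interpret P: wf_digraph "G \<box> H" using assms by (intro wf_digraph_cart_prod)
  obtain u where u: "u \<in> S" "(u, v) \<in> arcs_ends G ^^ hop_dist G S v"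
    using G.hop_dist_attained[OF assms(3,5,6,9)] by blast
  obtain x where x: "x \<in> T" "(x, y) \<in> arcs_ends H ^^ hop_dist H T y"
    using H.hop_dist_attained[OF assms(4,7,8,10)] by blast
  have "((u, x), (v, y)) \<in> arcs_ends (G \<box> H) ^^ (hop_dist G S v + hop_dist H T y)"
    using u x assms by (subst relpow_cart_prod_iff) auto
  then show "hop_dist (G \<box> H) (S \<times> T) (v, y) \<le> hop_dist G S v + hop_dist H T y"
    using u(1) x(1) by (intro hop_dist_le[of "(u, x)"]) auto
  have "S \<times> T \<subseteq> verts (G \<box> H)" "S \<times> T \<noteq> {}" "(v, y) \<in> verts (G \<box> H)"
    using assms by auto
  then obtain a where "a \<in> S \<times> T"
    "(a, (v, y)) \<in> arcs_ends (G \<box> H) ^^ hop_dist (G \<box> H) (S \<times> T) (v, y)"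
    using P.hop_dist_attained[OF strongly_connected_cart_prod[OF assms(1-4)]] by metis
  then obtain u' x' i j where "u' \<in> S" "x' \<in> T"
    and sum: "hop_dist (G \<box> H) (S \<times> T) (v, y) = i + j"
    and "(u', v) \<in> arcs_ends G ^^ i" "(x', y) \<in> arcs_ends H ^^ j"
    using assms(5,7) by (auto simp: relpow_cart_prod_iff[OF assms(1)] subset_iff)
  then show "hop_dist G S v + hop_dist H T y \<le> hop_dist (G \<box> H) (S \<times> T) (v, y)"
    unfolding sum by (intro add_mono hop_dist_le)
qed

lemma last_level_cart_prod:
  assumes "graph G" "graph H"
    and sc: "strongly_connected G" "strongly_connected H"
    and S: "S \<subseteq> verts G" "S \<noteq> {}" and T: "T \<subseteq> verts H" "T \<noteq> {}"
  shows "dist_level (G \<box> H) (S \<times> T) (max_level (G \<box> H) (S \<times> T)) =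
    dist_level G S (max_level G S) \<times> dist_level H T (max_level H T)"
proof -
  interpret G: graph G by fact
  interpret H: graph H by fact
  interpret P: graph "G \<box> H" using assms by (intro graph_cart_prod)
  have dist: "hop_dist (G \<box> H) (S \<times> T) (v, y) = hop_dist G S v + hop_dist H T y"
    if "v \<in> verts G" "y \<in> verts H" for v y
    using that sc S T by (intro hop_dist_cart_prod G.wf_digraph H.wf_digraph)
  have sum_max: "(\<forall>w \<in> verts G. \<forall>z \<in> verts H.
        hop_dist G S w + hop_dist H T z \<le> hop_dist G S v + hop_dist H T y) \<longleftrightarrow>
      (\<forall>w \<in> verts G. hop_dist G S w \<le> hop_dist G S v) \<and>
      (\<forall>z \<in> verts H. hop_dist H T z \<le> hop_dist H T y)"
    (is "?sum \<longleftrightarrow> ?max") if "v \<in> verts G" "y \<in> verts H" for v y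
  proof
    \<comment> \<open>Compare \<open>(v, y)\<close> with \<open>(w, y)\<close> and with
      \<open>(v, z)\<close>, then cancel the common summand.\<close>
    show ?max if ?sum
      using that \<open>v \<in> verts G\<close> \<open>y \<in> verts H\<close> by (metis add_le_cancel_left add_le_cancel_right)
    show ?sum if ?max
      using that by (simp add: add_mono)
  qed
  have "strongly_connected (G \<box> H)"
    using sc by (intro strongly_connected_cart_prod G.wf_digraph H.wf_digraph)
  moreover have "S \<times> T \<subseteq> verts (G \<box> H)" "S \<times> T \<noteq> {}"
    using S T by auto
  ultimately show ?thesis
    unfolding G.last_level_eq[OF sc(1) S] H.last_level_eq[OF sc(2) T]
    by (auto simp: dist sum_max P.last_level_eq add_mono)
qed

text \<open>Arcs of a product are pairs of vertices, so both sides have literally the same arcs. The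
  fixed coordinate of an arc must lie in \<open>verts G\<close> or \<open>verts H\<close> on the
  left and in \<open>A\<close> or \<open>B\<close> on the right; the inclusions reconcile
  this.\<close>

lemma induce_cart_prod:
  assumes "A \<subseteq> verts G" "B \<subseteq> verts H"
  shows "(G \<box> H) \<restriction> (A \<times> B) = (G \<restriction> A) \<box> (H \<restriction> B)"
proof -
  have "u \<rightarrow>\<^bsub>G \<restriction> A\<^esub> v \<longleftrightarrow> u \<rightarrow>\<^bsub>G\<^esub> v \<and> u \<in> A \<and> v \<in> A"
    "x \<rightarrow>\<^bsub>H \<restriction> B\<^esub> y \<longleftrightarrow> x \<rightarrow>\<^bsub>H\<^esub> y \<and> x \<in> B \<and> y \<in> B" for u v x y
    by (auto simp: arcs_ends_conv induce_subgraph_def)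
  then show ?thesis
    using assms by (intro pre_digraph.equality) auto
qed

lemma (in wf_digraph) digraph_iso_refl: "digraph_iso G G"
proof -
  \<comment> \<open>The last two fields are the head and tail maps of the image graph, so reusing
    those of \<open>G\<close> makes \<open>app_iso\<close> return \<open>G\<close> itself.\<close>
  let ?h = "\<lparr>iso_verts = id, iso_arcs = id, iso_head = head G, iso_tail = tail G\<rparr>"
  have "digraph_isomorphism ?h"
    by (auto simp: digraph_isomorphism_def wf_digraph)
  moreover have "G = app_iso ?h G"
    by (simp add: app_iso_def)
  ultimately show ?thesis
    unfolding digraph_iso_def by blast
qed

theorem theorem3:
  fixes G R\<^sub>G :: "('a,'b) pre_digraph" and H R\<^sub>H :: "('c,'d) pre_digraph"
  assumes "graph G" and "Digraph_Component.connected G"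
    and "graph H" and "Digraph_Component.connected H"
    and "is_root G R\<^sub>G" and "is_root H R\<^sub>H"
  shows "digraph_iso (Res (G \<box> H) (R\<^sub>G \<box> R\<^sub>H)) (Res G R\<^sub>G \<box> Res H R\<^sub>H)"
proof -
  interpret G: graph G by fact
  interpret H: graph H by fact
  interpret P: graph "G \<box> H" using assms by (intro graph_cart_prod)
  \<comment> \<open>Edges are pairs of opposite arcs, so connectedness already gives directed walks
    between any two vertices.\<close>
  have sc: "strongly_connected G" "strongly_connected H"
    using assms G.symmetric_connected_imp_strongly_connected
      H.symmetric_connected_imp_strongly_connected G.sym_arcs H.sym_arcs by blast+
  have "verts R\<^sub>G \<subseteq> verts G" "verts R\<^sub>G \<noteq> {}" "verts R\<^sub>H \<subseteq> verts H" "verts R\<^sub>H \<noteq> {}"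
    using assms by (auto simp: is_root_def induced_subgraph_def subgraph_def)
  then have "dist_level (G \<box> H) (verts (R\<^sub>G \<box> R\<^sub>H)) (max_level (G \<box> H) (verts (R\<^sub>G \<box> R\<^sub>H))) =
      dist_level G (verts R\<^sub>G) (max_level G (verts R\<^sub>G)) \<times>
      dist_level H (verts R\<^sub>H) (max_level H (verts R\<^sub>H))"
    using sc by (simp add: last_level_cart_prod assms)
  \<comment> \<open>Unfolding \<open>dist_level_def\<close> shows that the last levels consist of
    vertices, as \<open>induce_cart_prod\<close> requires.\<close>
  then have "Res (G \<box> H) (R\<^sub>G \<box> R\<^sub>H) = Res G R\<^sub>G \<box> Res H R\<^sub>H"
    by (simp add: Res_def induce_cart_prod dist_level_def)
  moreover have "wf_digraph (Res (G \<box> H) (R\<^sub>G \<box> R\<^sub>H))"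
    unfolding Res_def by (rule P.wellformed_induce_subgraph)
  ultimately show ?thesis
    using wf_digraph.digraph_iso_refl by metis
qed

end
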